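(* Let $X$ and $Z$ be Hausdorff topological vector spaces, let $C\subseteq Z$ be a convex and pointed cone with nonempty interior and let $K$ be a nonempty subset of $X$. Consider a mapping $F:K\times K\times K\to Z$ and the two problems (P) find $x_0\in K$ such that $F(x_0,y,x_0)\notin-\operatorname{int}C$ for all $y\in K$; (D) find $x_0\in K$ such that $F(x_0,y,y)\notin-\operatorname{int}C$ for all $y\in K$. Then the following statements hold. (i) If $F$ is weakly $C$-pseudomonotone with respect to the third variable, then every $x\in K$ which solves (P) is also a solution of (D). (ii) Assume that $K$ is convex and $F(x,x,y)\in -C$ for all $x,y\in K$, $x\neq y$. If $F$ is weakly explicitly $C$-quasiconvex with respect to the second variable and is weakly $C$-hemicontinuous with respect to the third variable, then every $x\in K$ which solves (D) is also a solution of (P).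
   Context: All spaces are real. A cone $C$ satisfies $tc\in C$ for all $c\in C$, $t\ge 0$; it is convex if $C+C=C$ and pointed if $C\cap(-C)=\{0\}$ ($C$ is not assumed closed). $\operatorname{int}C$ is the interior of $C$. $F$ is weakly $C$-pseudomonotone with respect to the third variable if for all $x,y\in K$: $F(x,y,x)\notin-\operatorname{int}C$ implies $F(x,y,y)\notin-\operatorname{int}C$. For $K$ convex, $F$ is weakly explicitly $C$-quasiconvex with respect to the second variable if for all $x,y,z\in K$ with $x\ne y$ and all $t\in\,]0,1[$ one has $F(x,(1-t)x+ty,z)-F(x,x,z)\in-\operatorname{int}C$ or $F(x,(1-t)x+ty,z)-F(x,y,z)\in-\operatorname{int}C$. For $K$ convex, $F$ is weakly $C$-hemicontinuous with respect to the third variable if for all $x,y\in K$ such that $F(x,y,(1-t)x+ty)\notin-\operatorname{int}C$ for all $t\in\,]0,1]$ one has $F(x,y,x)\notin-\operatorname{int}C$. *)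

theory Defs
  imports "HOL-Analysis.Analysis" "HOL-Library.Set_Algebras"
begin

text \<open>
  Real topological vector spaces. The Hausdorff axiom is not included; it is added through
  the sort \<^class>\<open>t2_space\<close>. The axiom is joint continuity of scalar multiplication, stated
  with product filters in the same way as \<^class>\<open>topological_monoid_add\<close> in the library.
\<close>

class real_tvs = real_vector + topological_ab_group_add +
  assumes tendsto_scaleR_nhds:
    "filterlim (\<lambda>p. fst p *\<^sub>R snd p) (nhds (c *\<^sub>R x)) (nhds c \<times>\<^sub>F nhds x)"

instance real_normed_vector \<subseteq> real_tvs
proof
  fix c :: real and x :: 'a
  show "filterlim (\<lambda>p. fst p *\<^sub>R snd p) (nhds (c *\<^sub>R x)) (nhds c \<times>\<^sub>F nhds x)"
    by (intro tendsto_scaleR filterlim_fst filterlim_snd)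
qed

text \<open>
  On sets, unary minus is the complement in Isabelle, so the reflected set is always
  written \<^term>\<open>uminus ` C\<close>. The sum \<^term>\<open>C + C\<close> is the Minkowski sum.
\<close>

definition convex_pointed_cone :: "'z::real_vector set \<Rightarrow> bool" where
  "convex_pointed_cone C \<longleftrightarrow> cone C \<and> C + C = C \<and> C \<inter> uminus ` C = {0}"

text \<open>
  A mapping \<open>K \<times> K \<times> K \<rightarrow> Z\<close> is represented by a curried total function; only its values
  on \<open>K\<close> are ever used (for the notions involving segments, because \<open>K\<close> is convex).
\<close>

definition solves_P :: "'z::real_tvs set \<Rightarrow> 'x set \<Rightarrow> ('x \<Rightarrow> 'x \<Rightarrow> 'x \<Rightarrow> 'z) \<Rightarrow> 'x \<Rightarrow> bool" where
  "solves_P C K F x0 \<longleftrightarrow> x0 \<in> K \<and> (\<forall>y\<in>K. F x0 y x0 \<notin> uminus ` interior C)"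

definition solves_D :: "'z::real_tvs set \<Rightarrow> 'x set \<Rightarrow> ('x \<Rightarrow> 'x \<Rightarrow> 'x \<Rightarrow> 'z) \<Rightarrow> 'x \<Rightarrow> bool" where
  "solves_D C K F x0 \<longleftrightarrow> x0 \<in> K \<and> (\<forall>y\<in>K. F x0 y y \<notin> uminus ` interior C)"

definition weakly_pseudomonotone_3 ::
  "'z::real_tvs set \<Rightarrow> 'x set \<Rightarrow> ('x \<Rightarrow> 'x \<Rightarrow> 'x \<Rightarrow> 'z) \<Rightarrow> bool" where
  "weakly_pseudomonotone_3 C K F \<longleftrightarrow>
    (\<forall>x\<in>K. \<forall>y\<in>K. F x y x \<notin> uminus ` interior C \<longrightarrow> F x y y \<notin> uminus ` interior C)"

definition weakly_explicitly_quasiconvex_2 ::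
  "'z::real_tvs set \<Rightarrow> 'x::real_vector set \<Rightarrow> ('x \<Rightarrow> 'x \<Rightarrow> 'x \<Rightarrow> 'z) \<Rightarrow> bool" where
  "weakly_explicitly_quasiconvex_2 C K F \<longleftrightarrow>
    (\<forall>x\<in>K. \<forall>y\<in>K. \<forall>z\<in>K. x \<noteq> y \<longrightarrow> (\<forall>t\<in>{0<..<1::real}.
       F x ((1 - t) *\<^sub>R x + t *\<^sub>R y) z - F x x z \<in> uminus ` interior C \<or>
       F x ((1 - t) *\<^sub>R x + t *\<^sub>R y) z - F x y z \<in> uminus ` interior C))"

definition weakly_hemicontinuous_3 ::
  "'z::real_tvs set \<Rightarrow> 'x::real_vector set \<Rightarrow> ('x \<Rightarrow> 'x \<Rightarrow> 'x \<Rightarrow> 'z) \<Rightarrow> bool" where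
  "weakly_hemicontinuous_3 C K F \<longleftrightarrow>
    (\<forall>x\<in>K. \<forall>y\<in>K.
       (\<forall>t\<in>{0<..1::real}. F x y ((1 - t) *\<^sub>R x + t *\<^sub>R y) \<notin> uminus ` interior C) \<longrightarrow>
       F x y x \<notin> uminus ` interior C)"

end

theory Submission
  imports Defs
begin

text \<open>
  The interior of a convex cone absorbs the cone: \<open>int C + C \<subseteq> int C\<close>. Hence \<open>p - q \<in> -int C\<close> and
  \<open>q \<in> -C\<close> force \<open>p \<in> -int C\<close>, which is \<open>minus_interior_absorbs_minus_cone\<close>.

  The implication from (P) to (D) is weak pseudomonotonicity applied to the given point and each \<open>y\<close>.
  For the converse, let \<open>x\<close> solve (D), let \<open>y \<noteq> x\<close> and put \<open>z = (1 - t) x + t y\<close> with \<open>0 < t < 1\<close>.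
  Weak hemicontinuity reduces the claim \<open>F(x, y, x) \<notin> -int C\<close> to \<open>F(x, y, z) \<notin> -int C\<close> for all
  such \<open>t\<close>, the case \<open>t = 1\<close> being (D) itself. By quasiconvexity, with \<open>z\<close> also in the third place,
  \<open>F(x, z, z)\<close> lies in \<open>-int C\<close> plus one of \<open>F(x, x, z)\<close> and \<open>F(x, y, z)\<close>. The first of these is in
  \<open>-C\<close> by hypothesis, and so would be the second if it were in \<open>-int C\<close>. Absorption then gives
  \<open>F(x, z, z) \<in> -int C\<close>, against (D) at the point \<open>z\<close>.
\<close>

text \<open>
  Translation by an element of \<open>C\<close> is a homeomorphism that maps \<open>C\<close> into itself, so it maps the
  interior onto an open subset of \<open>C\<close>.
\<close>

lemma interior_add_absorbs:
  fixes C :: "'z::topological_ab_group_add set"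
  assumes "C + C \<subseteq> C" and "u \<in> interior C" and "c \<in> C"
  shows "u + c \<in> interior C"
proof (rule interiorI)
  show "open ((\<lambda>z. z - c) -` interior C)"
    by (intro open_vimage continuous_intros) simp
  show "u + c \<in> (\<lambda>z. z - c) -` interior C"
    using assms(2) by simp
  show "(\<lambda>z. z - c) -` interior C \<subseteq> C"
  proof
    fix z
    assume "z \<in> (\<lambda>z. z - c) -` interior C"
    then have "z - c \<in> C"
      using interior_subset by auto
    then have "(z - c) + c \<in> C + C"
      using assms(3) by (rule set_plus_intro)
    then show "z \<in> C"
      using assms(1) by auto
  qed
qed

lemma minus_interior_absorbs_minus_cone:
  fixes C :: "'z::topological_ab_group_add set"
  assumes "C + C \<subseteq> C" and "p - q \<in> uminus ` interior C" and "q \<in> uminus ` C"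
  shows "p \<in> uminus ` interior C"
proof -
  obtain u where u: "u \<in> interior C" "p - q = - u"
    using assms(2) by auto
  obtain c where c: "c \<in> C" "q = - c"
    using assms(3) by auto
  have "p = (p - q) + q"
    by simp
  also have "\<dots> = - u + q"
    by (simp only: u(2))
  also have "\<dots> = - (u + c)"
    using c(2) by simp
  finally show ?thesis
    using interior_add_absorbs[OF assms(1) u(1) c(1)] by blast
qed

lemma solves_P_imp_solves_D:
  assumes "weakly_pseudomonotone_3 C K F" and "solves_P C K F x"
  shows "solves_D C K F x"
  using assms unfolding weakly_pseudomonotone_3_def solves_P_def solves_D_def by blast

lemma solves_D_imp_solves_P:
  fixes C :: "'z::real_tvs set" and K :: "'x::real_vector set"
  assumes add: "C + C \<subseteq> C" and "convex K"
    and diag: "\<And>x y. x \<in> K \<Longrightarrow> y \<in> K \<Longrightarrow> x \<noteq> y \<Longrightarrow> F x x y \<in> uminus ` C"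
    and qc: "weakly_explicitly_quasiconvex_2 C K F"
    and hemi: "weakly_hemicontinuous_3 C K F"
    and D: "solves_D C K F x"
  shows "solves_P C K F x"
proof -
  have xK: "x \<in> K" and notin: "\<And>y. y \<in> K \<Longrightarrow> F x y y \<notin> uminus ` interior C"
    using D unfolding solves_D_def by auto
  have "F x y x \<notin> uminus ` interior C" if yK: "y \<in> K" for y
  proof (cases "x = y")
    case True
    then show ?thesis
      using notin[OF xK] by simp
  next
    case False
    have "F x y ((1 - t) *\<^sub>R x + t *\<^sub>R y) \<notin> uminus ` interior C" if t: "t \<in> {0<..1}" for t :: real
    proof (cases "t = 1")
      case True
      then show ?thesis
        using notin[OF yK] by simp
    next
      case t1: False
      define z where "z = (1 - t) *\<^sub>R x + t *\<^sub>R y"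
      have zK: "z \<in> K"
        unfolding z_def using t by (intro convexD \<open>convex K\<close> xK yK) auto
      have "z - x = t *\<^sub>R (y - x)"
        unfolding z_def by (simp add: algebra_simps)
      then have "x \<noteq> z"
        using False t by auto
      then have xxz: "F x x z \<in> uminus ` C"
        using diag xK zK by blast
      have "F x z z - F x x z \<in> uminus ` interior C \<or> F x z z - F x y z \<in> uminus ` interior C"
        using qc xK yK zK False t t1 unfolding weakly_explicitly_quasiconvex_2_def z_def by force
      moreover have "F x z z - F x x z \<notin> uminus ` interior C"
        using minus_interior_absorbs_minus_cone[OF add _ xxz] notin[OF zK] by blast
      ultimately have diff: "F x z z - F x y z \<in> uminus ` interior C"
        by blast
      have "F x y z \<notin> uminus ` C"
        using minus_interior_absorbs_minus_cone[OF add diff] notin[OF zK] by blast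
      then show ?thesis
        unfolding z_def[symmetric] using interior_subset by blast
    qed
    then show ?thesis
      using hemi xK yK unfolding weakly_hemicontinuous_3_def by blast
  qed
  then show ?thesis
    using xK unfolding solves_P_def by blast
qed

theorem theorem3p1:
  fixes C :: "'z::{real_tvs, t2_space} set"
    and K :: "'x::{real_tvs, t2_space} set"
    and F :: "'x \<Rightarrow> 'x \<Rightarrow> 'x \<Rightarrow> 'z"
  assumes "convex_pointed_cone C" and "interior C \<noteq> {}" and "K \<noteq> {}"
  shows "(weakly_pseudomonotone_3 C K F \<longrightarrow> (\<forall>x\<in>K. solves_P C K F x \<longrightarrow> solves_D C K F x)) \<and>
    (convex K \<and>
     (\<forall>x\<in>K. \<forall>y\<in>K. x \<noteq> y \<longrightarrow> F x x y \<in> uminus ` C) \<and>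
     weakly_explicitly_quasiconvex_2 C K F \<and>
     weakly_hemicontinuous_3 C K F
     \<longrightarrow> (\<forall>x\<in>K. solves_D C K F x \<longrightarrow> solves_P C K F x))"
proof -
  have "C + C \<subseteq> C"
    using assms(1) unfolding convex_pointed_cone_def by simp
  then show ?thesis
    using solves_P_imp_solves_D[of C K F] solves_D_imp_solves_P[of C K F] by blast
qed

end
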